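(* Let $n\ge 1$ and let $$A=\begin{bmatrix}0&w_1&&\\&0&\ddots&\\&&\ddots&w_{n-1}\\&&&0\end{bmatrix}$$ be an $n$-by-$n$ complex matrix with $w_j\neq 0$ for all $j$, $1\le j\le n-1$. Then $d(A)=i_{\ge 0}(\mathrm{Re}(e^{-i\theta}A))=\lceil n/2\rceil$ for all real $\theta$.
   Context: For an $n$-by-$n$ complex matrix $A$, the zero-dilation index $d(A)$ is the largest integer $k\ge 1$ such that there is an $n$-by-$k$ complex matrix $V$ with $V^*V=I_k$ and $V^*AV=0_k$, where $0_k$ is the $k$-by-$k$ zero matrix; if no such $k$ exists, $d(A)=0$. $\mathrm{Re}\,B=(B+B^* )/2$. For a Hermitian matrix $C$, $i_{\ge 0}(C)$ is the number of nonnegative eigenvalues of $C$, counting multiplicity. The only nonzero entries of $A$ are the $(j,j+1)$ entries $w_j$, $1\le j\le n-1$. *)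

theory Defs
  imports Complex_Main "Jordan_Normal_Form.Char_Poly" "Jordan_Normal_Form.Schur_Decomposition"
begin

(* A^* is mat_adjoint A, the conjugate transpose. *)

definition zero_dilation_dims :: "complex mat \<Rightarrow> nat set" where
  "zero_dilation_dims A =
     {k. 1 \<le> k \<and> (\<exists>V \<in> carrier_mat (dim_row A) k.
            mat_adjoint V * V = 1\<^sub>m k \<and> mat_adjoint V * A * V = 0\<^sub>m k k)}"

(* Max is applied to a finite set: V^* V = I_k says that the k columns of V are
   orthonormal, so k is at most dim_row A. *)
definition zero_dilation_index :: "complex mat \<Rightarrow> nat" where
  "zero_dilation_index A =
     (if zero_dilation_dims A = {} then 0 else Max (zero_dilation_dims A))"

definition Re_mat :: "complex mat \<Rightarrow> complex mat" where
  "Re_mat B = (1 / 2) \<cdot>\<^sub>m (B + mat_adjoint B)"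

(* Used for Hermitian C only, so all eigenvalues are real and the algebraic
   multiplicity (the order as a root of the characteristic polynomial) is also
   the geometric one. *)
definition num_nonneg_eigenvalues :: "complex mat \<Rightarrow> nat" where
  "num_nonneg_eigenvalues C =
     (\<Sum>x \<in> {x :: real. 0 \<le> x \<and> eigenvalue C (complex_of_real x)}.
        order (complex_of_real x) (char_poly C))"

(* Matrix indices start at 0 while the weights are w 1, ..., w (n - 1):
   the entry in row j and column j + 1, counted from 1, is w j. *)
definition weighted_shift_mat :: "nat \<Rightarrow> (nat \<Rightarrow> complex) \<Rightarrow> complex mat" where
  "weighted_shift_mat n w = mat n n (\<lambda>(r, c). if c = r + 1 then w (r + 1) else 0)"

end

theory Submission
  imports Defs
begin

text \<open>
  The matrix \<open>C = Re (e\<^sup>-\<^sup>i\<^sup>\<theta> A)\<close> is Hermitian and tridiagonal with zero diagonal. The three-term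
  recurrence of its characteristic polynomial \<open>p\<close> gives \<open>p (-x) = (-1)\<^sup>n p x\<close>, so the spectrum is
  symmetric about 0, and shows that 0 is a root of order \<open>n mod 2\<close>. Since all roots are real, exactly
  \<open>(n + n mod 2) / 2\<close> of them are nonnegative.

  For \<open>d(A)\<close>, the unit vectors with even 0-based index span a space of dimension \<open>\<lceil>n/2\<rceil>\<close> whose
  compression of \<open>A\<close> is zero. Conversely, if the compression to a space \<open>S\<close> of dimension \<open>k\<close> is zero, then
  \<open>A S\<close> is orthogonal to \<open>S\<close> and has dimension at least \<open>k - 1\<close>, because \<open>ker A\<close> is
  one-dimensional; hence \<open>2 k - 1 \<le> n\<close>.
\<close>

section \<open>Entries of adjoints and products with zero\<close>

lemma mat_adjoint_index:
  assumes "i < dim_col A" "j < dim_row A"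
  shows "mat_adjoint A $$ (i, j) = conjugate (A $$ (j, i))"
  using assms unfolding mat_adjoint_def by (simp add: mat_of_rows_index)

lemma mat_adjoint_dim [simp]:
  "dim_row (mat_adjoint A) = dim_col A" "dim_col (mat_adjoint A) = dim_row A"
  unfolding mat_adjoint_def by auto

lemma zero_mat_mult_vec: "v \<in> carrier_vec n \<Longrightarrow> 0\<^sub>m m n *\<^sub>v v = 0\<^sub>v m"
  by (intro eq_vecI) auto

lemma mult_mat_zero_vec: "A \<in> carrier_mat m n \<Longrightarrow> A *\<^sub>v 0\<^sub>v n = 0\<^sub>v m"
  by (intro eq_vecI) auto

section \<open>Tridiagonal matrices and the three-term recurrence\<close>

definition tridiag_mat :: "(nat \<Rightarrow> 'a) \<Rightarrow> (nat \<Rightarrow> 'a) \<Rightarrow> (nat \<Rightarrow> 'a) \<Rightarrow> nat \<Rightarrow> 'a :: zero mat" where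
  "tridiag_mat a b c n =
     mat n n (\<lambda>(i, j). if i = j then a i else if j = Suc i then b i else if i = Suc j then c j else 0)"

lemma tridiag_mat_carrier [simp]: "tridiag_mat a b c n \<in> carrier_mat n n"
  unfolding tridiag_mat_def by simp

lemma tridiag_mat_dim [simp]:
  "dim_row (tridiag_mat a b c n) = n" "dim_col (tridiag_mat a b c n) = n"
  unfolding tridiag_mat_def by simp_all

text \<open>Laplace expansion along the last row meets two nonzero positions; the off-diagonal minor
  is then expanded along its last column, where only \<open>b n\<close> survives.\<close>

lemma det_tridiag_mat_Suc_Suc:
  fixes a b c :: "nat \<Rightarrow> 'a :: comm_ring_1"
  shows "det (tridiag_mat a b c (Suc (Suc n))) =
    a (Suc n) * det (tridiag_mat a b c (Suc n)) - b n * c n * det (tridiag_mat a b c n)"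
proof -
  let ?T = "tridiag_mat a b c (Suc (Suc n))"
  let ?U = "mat_delete ?T (Suc n) n"
  have T: "?T \<in> carrier_mat (Suc (Suc n)) (Suc (Suc n))" by simp
  have U: "?U \<in> carrier_mat (Suc n) (Suc n)"
    by (rule carrier_matI) simp_all
  have minor: "mat_delete ?T (Suc n) (Suc n) = tridiag_mat a b c (Suc n)"
    by (rule eq_matI) (auto simp: mat_delete_def tridiag_mat_def)
  have minor': "mat_delete ?U n n = tridiag_mat a b c n"
    by (rule eq_matI) (auto simp: mat_delete_def tridiag_mat_def)
  \<comment> \<open>Deleting column \<open>n\<close> shifts the original column \<open>Suc n\<close>
    into position \<open>n\<close>; apart from the deleted row, its only nonzero entry is
    \<open>b n\<close>, in row \<open>n\<close>.\<close>
  have U_index: "?U $$ (i, n) = (if i = n then b n else 0)" if "i < Suc n" for i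
    using that by (auto simp: mat_delete_def tridiag_mat_def)
  have "det ?U = (\<Sum>i<Suc n. ?U $$ (i, n) * cofactor ?U i n)"
    by (rule laplace_expansion_column[OF U]) simp
  also have "\<dots> = (\<Sum>i\<in>{n}. ?U $$ (i, n) * cofactor ?U i n)"
    by (rule sum.mono_neutral_right) (auto simp: U_index)
  also have "\<dots> = b n * det (tridiag_mat a b c n)"
    by (simp add: U_index cofactor_def minor')
  finally have detU: "det ?U = b n * det (tridiag_mat a b c n)" .
  have "det ?T = (\<Sum>j<Suc (Suc n). ?T $$ (Suc n, j) * cofactor ?T (Suc n) j)"
    by (rule laplace_expansion_row[OF T]) simp
  also have "\<dots> = (\<Sum>j\<in>{n, Suc n}. ?T $$ (Suc n, j) * cofactor ?T (Suc n) j)"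
    by (rule sum.mono_neutral_right) (auto simp: tridiag_mat_def)
  also have "\<dots> = c n * cofactor ?T (Suc n) n + a (Suc n) * cofactor ?T (Suc n) (Suc n)"
    by (simp add: tridiag_mat_def)
  also have "\<dots> = a (Suc n) * det (tridiag_mat a b c (Suc n)) - b n * c n * det (tridiag_mat a b c n)"
    unfolding cofactor_def minor detU by (simp add: algebra_simps)
  finally show ?thesis .
qed

text \<open>The characteristic matrix is again tridiagonal, now over the polynomial ring, so the
  determinant recurrence carries over to characteristic polynomials.\<close>

lemma char_poly_tridiag_mat:
  fixes a b c :: "nat \<Rightarrow> 'a :: comm_ring_1"
  shows "char_poly (tridiag_mat a b c n) =
    det (tridiag_mat (\<lambda>i. [:- a i, 1:]) (\<lambda>i. [:- b i:]) (\<lambda>i. [:- c i:]) n)"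
  unfolding char_poly_defs
  by (rule arg_cong[of _ _ det], rule eq_matI) (auto simp: tridiag_mat_def)

lemma char_poly_tridiag_mat_0: "char_poly (tridiag_mat a b c 0) = 1"
  unfolding char_poly_tridiag_mat by (simp add: tridiag_mat_def)

lemma char_poly_tridiag_mat_1: "char_poly (tridiag_mat a b c (Suc 0)) = [:- a 0, 1:]"
  unfolding char_poly_tridiag_mat by (subst det_single) (simp_all add: tridiag_mat_def)

lemma char_poly_tridiag_mat_Suc_Suc:
  fixes a b c :: "nat \<Rightarrow> 'a :: comm_ring_1"
  shows "char_poly (tridiag_mat a b c (Suc (Suc n))) =
    [:- a (Suc n), 1:] * char_poly (tridiag_mat a b c (Suc n))
    - smult (b n * c n) (char_poly (tridiag_mat a b c n))"
  unfolding char_poly_tridiag_mat det_tridiag_mat_Suc_Suc by (simp add: mult.commute)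

section \<open>Zero diagonal: symmetry of the spectrum about 0\<close>

abbreviation zero_diag_mat :: "(nat \<Rightarrow> 'a) \<Rightarrow> (nat \<Rightarrow> 'a) \<Rightarrow> nat \<Rightarrow> 'a :: zero mat" where
  "zero_diag_mat \<equiv> tridiag_mat (\<lambda>_. 0)"

text \<open>By the recurrence, the sign flips with the factor \<open>[:0, 1:]\<close> in one term,
  while the other term comes from size \<open>n\<close>, which has the parity of
  \<open>n + 2\<close>.\<close>

lemma char_poly_zero_diag_mat_reflect:
  fixes b c :: "nat \<Rightarrow> 'a :: comm_ring_1"
  shows "char_poly (zero_diag_mat b c n) \<circ>\<^sub>p [:0, -1:] = smult ((-1) ^ n) (char_poly (zero_diag_mat b c n))"
proof (induction n rule: induct_nat_012)
  case 0
  then show ?case by (simp add: char_poly_tridiag_mat_0)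
next
  case 1
  then show ?case by (simp add: char_poly_tridiag_mat_1 pcompose_pCons)
next
  case (ge2 n)
  then show ?case
    by (simp add: char_poly_tridiag_mat_Suc_Suc pcompose_diff pcompose_smult pcompose_pCons smult_diff_right mult.commute)
qed

text \<open>Substituting -X turns a power of X + a into a power of X - a, up to sign. This gives one
  inequality, and the substitution is an involution.\<close>

lemma order_uminus_pcompose:
  fixes p :: "'a :: idom poly"
  assumes "p \<noteq> 0"
  shows "order (- a) p = order a (p \<circ>\<^sub>p [:0, -1:])"
proof -
  have invol: "q \<circ>\<^sub>p [:0, -1:] \<circ>\<^sub>p [:0, -1:] = q" for q :: "'a poly"
    by (simp add: pcompose_assoc[symmetric] pcompose_pCons pcompose_idR)
  have pow: "([:- x, 1:] ^ m) \<circ>\<^sub>p [:0, -1:] = smult ((-1) ^ m) ([:x, 1:] ^ m)" for x :: 'a and m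
  proof (induction m)
    case (Suc m)
    have "[:- x, 1:] \<circ>\<^sub>p [:0, -1:] = - [:x, 1:]" by (simp add: pcompose_pCons)
    then show ?case 
      by (simp only: power_Suc pcompose_mult Suc.IH mult_minus_left mult_smult_right mult_1_left smult_minus_left smult_minus_right)
  qed simp
  have le: "order (- x) q \<le> order x (q \<circ>\<^sub>p [:0, -1:])" if "q \<noteq> 0" for x :: 'a and q
  proof -
    let ?m = "order (- x) q"
    have nz: "q \<circ>\<^sub>p [:0, -1:] \<noteq> 0"
      using that invol[of q] by auto
    obtain r where "q = [:- (- x), 1:] ^ ?m * r"
      using order_1[of "- x" q] by (auto elim: dvdE)
    then have "q \<circ>\<^sub>p [:0, -1:] = ([:- (- x), 1:] ^ ?m) \<circ>\<^sub>p [:0, -1:] * (r \<circ>\<^sub>p [:0, -1:])"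
      by (metis pcompose_mult)
    also have "\<dots> = [:- x, 1:] ^ ?m * smult ((-1) ^ ?m) (r \<circ>\<^sub>p [:0, -1:])"
      unfolding pow by simp
    finally show ?thesis
      using nz by (metis dvd_triv_left order_divides)
  qed
  have "p \<circ>\<^sub>p [:0, -1:] \<noteq> 0"
    using assms invol[of p] by auto
  \<comment> \<open>The second instance, applied to the reflected polynomial at \<open>- a\<close>,
    is the reverse inequality.\<close>
  from le[OF assms, of a] le[OF this, of "- a"] show ?thesis
    by (simp add: invol)
qed

lemma order_char_poly_zero_diag_mat_uminus:
  fixes b c :: "nat \<Rightarrow> 'a :: idom"
  shows "order (- a) (char_poly (zero_diag_mat b c n)) = order a (char_poly (zero_diag_mat b c n))"
proof -
  have "char_poly (zero_diag_mat b c n) \<noteq> 0"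
    using degree_monic_char_poly[of "zero_diag_mat b c n" n] by auto
  then show ?thesis
    by (simp add: order_uminus_pcompose char_poly_zero_diag_mat_reflect order_smult)
qed

section \<open>Multiplicity of the eigenvalue 0\<close>

text \<open>In the recurrence \<open>b k * cnj (b k)\<close> is a squared modulus, so both
  contributions to a lowest coefficient carry the sign \<open>(-1) ^ m\<close> and cannot
  cancel.\<close>

lemma coeff_char_poly_hermitian_zero_diag_mat:
  fixes b :: "nat \<Rightarrow> complex"
  assumes "\<And>i. i < n \<Longrightarrow> b i \<noteq> 0"
  defines "p \<equiv> \<lambda>n. char_poly (zero_diag_mat b (\<lambda>i. cnj (b i)) n)"
  shows "2 * m \<le> Suc n \<Longrightarrow> \<exists>r s. r > 0 \<and> s > 0 \<and>
    coeff (p (2 * m)) 0 = complex_of_real ((-1) ^ m * r) \<and>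
    coeff (p (Suc (2 * m))) 0 = 0 \<and>
    coeff (p (Suc (2 * m))) 1 = complex_of_real ((-1) ^ m * s)"
proof (induction m)
  case 0
  have "(1 :: real) > 0" by simp
  then show ?case
    unfolding p_def by (auto simp: char_poly_tridiag_mat_0 char_poly_tridiag_mat_1)
next
  case (Suc m)
  then obtain r s where rs: "r > 0" "s > 0"
    "coeff (p (2 * m)) 0 = complex_of_real ((-1) ^ m * r)"
    "coeff (p (Suc (2 * m))) 0 = 0"
    "coeff (p (Suc (2 * m))) 1 = complex_of_real ((-1) ^ m * s)" by auto
  have rec: "p (Suc (Suc k)) = pCons 0 (p (Suc k)) - smult (complex_of_real ((cmod (b k))\<^sup>2)) (p k)" for k
    unfolding p_def by (simp add: char_poly_tridiag_mat_Suc_Suc complex_norm_square del: of_real_power)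
  have b: "b (2 * m) \<noteq> 0" using Suc.prems assms(1) by simp
  define r' where "r' = (cmod (b (2 * m)))\<^sup>2 * r"
  \<comment> \<open>The index \<open>Suc (2 * m)\<close> may equal \<open>n\<close>, where
    \<open>b\<close> is not known to be nonzero; positivity of \<open>s'\<close> therefore rests on
    \<open>r'\<close>.\<close>
  define s' where "s' = r' + (cmod (b (Suc (2 * m))))\<^sup>2 * s"
  have "r' > 0" using b rs by (simp add: r'_def)
  moreover have "s' > 0" using \<open>r' > 0\<close> rs by (simp add: s'_def add_pos_nonneg)
  moreover have e0: "coeff (p (Suc (Suc (2 * m)))) 0 = complex_of_real ((-1) ^ Suc m * r')"
    unfolding rec using rs by (simp add: r'_def)
  moreover have "coeff (p (Suc (Suc (Suc (2 * m))))) 0 = 0"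
    unfolding rec[of "Suc (2 * m)"] using rs by simp
  moreover have "coeff (p (Suc (Suc (Suc (2 * m))))) 1 = complex_of_real ((-1) ^ Suc m * s')"
    unfolding rec[of "Suc (2 * m)"] using rs e0 by (simp add: s'_def algebra_simps)
  ultimately show ?case by auto
qed

lemma order_0_char_poly_hermitian_zero_diag_mat:
  fixes b :: "nat \<Rightarrow> complex"
  assumes "\<And>i. Suc i < n \<Longrightarrow> b i \<noteq> 0"
  shows "order 0 (char_poly (zero_diag_mat b (\<lambda>i. cnj (b i)) n)) = n mod 2"
proof -
  let ?p = "char_poly (zero_diag_mat b (\<lambda>i. cnj (b i)) n)"
  have nz: "?p \<noteq> 0"
    using degree_monic_char_poly[of "zero_diag_mat b (\<lambda>i. cnj (b i)) n" n] by auto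
  have b: "\<And>i. i < n - 1 \<Longrightarrow> b i \<noteq> 0" using assms by simp
  have "2 * (n div 2) \<le> Suc (n - 1)" by simp
  \<comment> \<open>Size \<open>n\<close> involves only \<open>b 0\<close>, ...,
    \<open>b (n - 2)\<close>, hence the instance \<open>n - 1\<close>.\<close>
  note coeffs = coeff_char_poly_hermitian_zero_diag_mat[of "n - 1" b "n div 2", OF b this]
  show ?thesis
  proof (cases "even n")
    case True
    then obtain r where "r > 0" "coeff ?p 0 = complex_of_real ((-1) ^ (n div 2) * r)"
      using coeffs by auto
    then have "poly ?p 0 \<noteq> 0" by (simp add: poly_0_coeff_0)
    then show ?thesis using True by (simp add: order_0I even_iff_mod_2_eq_zero)
  next
    case False
    then have n: "Suc (2 * (n div 2)) = n" by simp
    obtain s where s: "s > 0" "coeff ?p 0 = 0" "coeff ?p 1 = complex_of_real ((-1) ^ (n div 2) * s)"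
      using coeffs unfolding n by auto
    have "order 0 ?p \<noteq> 0" using s(2) nz order_root[of ?p 0] by (simp add: poly_0_coeff_0)
    moreover have "order 0 ?p < 2"
    proof (rule ccontr)
      assume "\<not> order 0 ?p < 2"
      then have "monom 1 2 dvd ?p"
        using order_divides[of 0 2 ?p] nz by (simp add: monom_altdef)
      then have "coeff ?p 1 = 0" by (auto simp: monom_1_dvd_iff')
      with s show False by simp
    qed
    ultimately show ?thesis using False by (simp add: odd_iff_mod_2_eq_one)
  qed
qed

section \<open>Counting nonnegative eigenvalues\<close>

text \<open>The \<open>n\<close> complex roots are all real, and positive and negative ones have
  equal total multiplicity. Doubling the nonnegative count thus counts every root once and 0 once
  more.\<close>

lemma num_nonneg_eigenvalues_symmetric:
  assumes C: "C \<in> carrier_mat n n"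
    and real: "\<And>x. eigenvalue C x \<Longrightarrow> x \<in> \<real>"
    and symm: "\<And>x. order (- x) (char_poly C) = order x (char_poly C)"
  shows "2 * num_nonneg_eigenvalues C = n + order 0 (char_poly C)"
proof -
  let ?p = "char_poly C"
  let ?o = "\<lambda>x :: real. order (complex_of_real x) ?p"
  have nz: "?p \<noteq> 0" and deg: "degree ?p = n"
    using degree_monic_char_poly[OF C] by auto
  define R where "R = {x :: real. poly ?p (complex_of_real x) = 0}"
  have ev: "eigenvalue C x \<longleftrightarrow> poly ?p x = 0" for x
    by (rule eigenvalue_root_char_poly[OF C])
  have roots: "{z. poly ?p z = 0} = complex_of_real ` R"
    using real unfolding R_def ev by (auto elim!: Reals_cases)
  have finR: "finite R"
    using poly_roots_finite[OF nz] unfolding roots by (rule finite_imageD) (simp add: inj_on_def)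
  have mem: "x \<in> R \<longleftrightarrow> ?o x \<noteq> 0" for x
    unfolding R_def using nz by (simp add: order_root)
  have "n = size (proots ?p)" using size_proots_complex[of ?p] deg by simp
  also have "\<dots> = (\<Sum>z\<in>complex_of_real ` R. order z ?p)"
    using nz by (simp add: size_multiset_overloaded_eq roots)
  also have "\<dots> = sum ?o R"
    by (subst sum.reindex) (simp_all add: inj_on_def)
  also have "R = {x\<in>R. x > 0} \<union> {x\<in>R. x < 0} \<union> {x\<in>R. x = 0}" by auto
  also have "sum ?o \<dots> = sum ?o {x\<in>R. x > 0} + sum ?o {x\<in>R. x < 0} + sum ?o {x\<in>R. x = 0}"
    using finR by (subst sum.union_disjoint; (subst sum.union_disjoint)?; auto)
  also have "sum ?o {x\<in>R. x < 0} = sum ?o {x\<in>R. x > 0}"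
    by (rule sum.reindex_bij_witness[of _ uminus uminus]) (auto simp: mem symm)
  \<comment> \<open>If 0 is not a root, the sum is empty and the order is 0, so the formula covers
    this case too.\<close>
  also have zero: "sum ?o {x\<in>R. x = 0} = order 0 ?p"
  proof (cases "0 \<in> R")
    case True
    then have "{x\<in>R. x = 0} = {0}" by auto
    then show ?thesis by simp
  next
    case False
    then have "{x\<in>R. x = 0} = {}" by auto
    with False show ?thesis by (simp add: mem)
  qed
  finally have n: "n = 2 * sum ?o {x\<in>R. x > 0} + order 0 ?p" by simp
  have "num_nonneg_eigenvalues C = sum ?o ({x\<in>R. x > 0} \<union> {x\<in>R. x = 0})"
    unfolding num_nonneg_eigenvalues_def ev R_def by (rule sum.cong) auto
  also have "\<dots> = sum ?o {x\<in>R. x > 0} + order 0 ?p"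
    using finR unfolding zero[symmetric] by (subst sum.union_disjoint) auto
  finally show ?thesis using n by simp
qed

text \<open>For an eigenvector \<open>v\<close>, the quadratic form \<open>S\<close> is its own
  conjugate and equals \<open>x\<close> times the positive squared norm of \<open>v\<close>.\<close>

lemma hermitian_eigenvalue_real:
  fixes C :: "complex mat"
  assumes C: "C \<in> carrier_mat n n"
    and herm: "\<And>i j. i < n \<Longrightarrow> j < n \<Longrightarrow> C $$ (j, i) = cnj (C $$ (i, j))"
    and ev: "eigenvalue C x"
  shows "x \<in> \<real>"
proof -
  obtain v where v: "v \<in> carrier_vec n" "v \<noteq> 0\<^sub>v n" "C *\<^sub>v v = x \<cdot>\<^sub>v v"
    using ev C unfolding eigenvalue_def eigenvector_def by auto
  define S where "S = (\<Sum>i<n. \<Sum>j<n. C $$ (i, j) * v $ j * cnj (v $ i))"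
  have row: "(\<Sum>j<n. C $$ (i, j) * v $ j) = x * v $ i" if "i < n" for i
  proof -
    have "(C *\<^sub>v v) $ i = x * v $ i" using v that by simp
    then show ?thesis using C v(1) that
      by (simp add: scalar_prod_def lessThan_atLeast0)
  qed
  have "S = (\<Sum>i<n. x * v $ i * cnj (v $ i))"
    unfolding S_def by (rule sum.cong) (simp_all add: row sum_distrib_right[symmetric])
  also have "\<dots> = x * complex_of_real (\<Sum>i<n. (cmod (v $ i))\<^sup>2)"
    by (simp only: of_real_sum sum_distrib_left mult.assoc complex_norm_square)
  finally have S: "S = x * complex_of_real (\<Sum>i<n. (cmod (v $ i))\<^sup>2)" .
  have "cnj S = (\<Sum>i<n. \<Sum>j<n. C $$ (j, i) * cnj (v $ j) * v $ i)"
    unfolding S_def cnj_sum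
    by (intro sum.cong refl) (simp add: herm[symmetric])
  also have "\<dots> = S"
    unfolding S_def by (subst sum.swap) (simp add: mult_ac)
  finally have "cnj x * complex_of_real (\<Sum>i<n. (cmod (v $ i))\<^sup>2) = x * complex_of_real (\<Sum>i<n. (cmod (v $ i))\<^sup>2)"
    unfolding S by simp
  moreover have "(\<Sum>i<n. (cmod (v $ i))\<^sup>2) \<noteq> 0"
  proof
    assume "(\<Sum>i<n. (cmod (v $ i))\<^sup>2) = 0"
    then have "\<forall>i<n. v $ i = 0" by (subst (asm) sum_nonneg_eq_0_iff) auto
    with v show False by auto
  qed
  ultimately have "cnj x = x" by (simp del: of_real_sum)
  then show ?thesis by (simp add: Reals_cnj_iff)
qed

section \<open>The zero-dilation index of the shift\<close>

text \<open>\<open>W\<close> stands for the adjoint of \<open>V\<close>. The dimension count becomes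
  the singularity of an explicit square matrix, whose kernel vector is then shown to vanish.\<close>

lemma weighted_shift_compression_zero_dim_le:
  fixes A V W :: "complex mat"
  assumes n: "n \<ge> 1" and w: "\<And>j. 1 \<le> j \<Longrightarrow> j \<le> n - 1 \<Longrightarrow> w j \<noteq> 0"
    and A: "A = weighted_shift_mat n w"
    and V: "V \<in> carrier_mat n k" and W: "W \<in> carrier_mat k n"
    and WV: "W * V = 1\<^sub>m k" and WAV: "W * A * V = 0\<^sub>m k k"
  shows "2 * k \<le> n + 1"
proof (rule ccontr)
  assume "\<not> ?thesis"
  then have k: "2 * k \<ge> n + 2" by simp
  have cA: "A \<in> carrier_mat n n" unfolding A weighted_shift_mat_def by simp
  let ?m = "2 * k - n"
  txt \<open>We look for \<open>(x, y) \<noteq> 0\<close> with \<open>V x + A V y = 0\<close> and \<open>(V y)\<^sub>0 = 0\<close>: \<open>n + 1\<close> equations in \<open>2 k\<close> unknowns,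
    padded by zero rows to a singular square system.\<close>
  define R where "R = mat ?m k (\<lambda>(i, j). if i = 0 then V $$ (0, j) else 0)"
  have R: "R \<in> carrier_mat ?m k" unfolding R_def by simp
  have Z: "0\<^sub>m ?m k \<in> carrier_mat ?m k" by simp
  have AV: "A * V \<in> carrier_mat n k" using cA V by simp
  let ?M = "four_block_mat V (A * V) (0\<^sub>m ?m k) R"
  have M: "?M \<in> carrier_mat (k + k) (k + k)"
    using four_block_carrier_mat[OF V R] k by (simp add: mult_2)
  \<comment> \<open>Since \<open>?m\<close> is at least 2, the last row is padding and differs from
    row \<open>n\<close>, which carries the condition on the first coordinate of V y.\<close>
  have "?M $$ (k + k - 1, j) = 0" if "j < k + k" for j
    using that k n V R cA by (auto simp: R_def)
  then have "det ?M = 0"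
    using laplace_expansion_row[OF M, of "k + k - 1"] k by simp
  then obtain z where z: "z \<in> carrier_vec (k + k)" "z \<noteq> 0\<^sub>v (k + k)" "?M *\<^sub>v z = 0\<^sub>v (k + k)"
    using det_0_iff_vec_prod_zero[OF M] by auto
  define x y where "x = vec_first z k" and "y = vec_last z k"
  have x: "x \<in> carrier_vec k" and y: "y \<in> carrier_vec k" and zxy: "z = x @\<^sub>v y"
    using z(1) unfolding x_def y_def by auto
  have "(V *\<^sub>v x + (A * V) *\<^sub>v y) @\<^sub>v (0\<^sub>m ?m k *\<^sub>v x + R *\<^sub>v y) = 0\<^sub>v (k + k)"
    using four_block_mat_mult_vec[OF V AV Z R x y] z(3) zxy by simp
  also have "0\<^sub>v (k + k) = 0\<^sub>v n @\<^sub>v 0\<^sub>v ?m"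
    using k by (intro eq_vecI) auto
  also have "0\<^sub>m ?m k *\<^sub>v x + R *\<^sub>v y = R *\<^sub>v y"
    using x y R by (simp add: zero_mat_mult_vec)
  finally have "V *\<^sub>v x + (A * V) *\<^sub>v y = 0\<^sub>v n \<and> R *\<^sub>v y = 0\<^sub>v ?m"
    using V AV x y R by (subst (asm) append_vec_eq[of _ n]) auto
  then have eq: "V *\<^sub>v x + (A * V) *\<^sub>v y = 0\<^sub>v n" and Ry: "R *\<^sub>v y = 0\<^sub>v ?m" by auto
  \<comment> \<open>Applying \<open>W\<close> isolates \<open>x\<close>, because
    \<open>W * V\<close> is the identity and \<open>W * A * V\<close> vanishes.\<close>
  have "x = W *\<^sub>v (V *\<^sub>v x + (A * V) *\<^sub>v y)"
  proof -
    have "W *\<^sub>v (V *\<^sub>v x + (A * V) *\<^sub>v y) = (W * V) *\<^sub>v x + (W * (A * V)) *\<^sub>v y"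
      using W V x y AV by (simp add: mult_add_distrib_mat_vec[of _ k n] assoc_mult_mat_vec[OF W AV y] del: assoc_mult_mat)
    also have "W * (A * V) = W * A * V" using W cA V by simp
    finally show ?thesis using x y by (simp add: WV WAV zero_mat_mult_vec)
  qed
  then have x0: "x = 0\<^sub>v k" unfolding eq using W by (simp add: mult_mat_zero_vec)
  define u where "u = V *\<^sub>v y"
  have u: "u \<in> carrier_vec n" using V y by (simp add: u_def)
  have "A *\<^sub>v u = 0\<^sub>v n"
    using eq V cA y unfolding x0 u_def by (simp add: mult_mat_zero_vec)
  \<comment> \<open>The row of \<open>R\<close> kills coordinate 0, which spans the kernel of
    \<open>A\<close>; row \<open>j\<close> of A u = 0 reads
    \<open>w (j + 1) * u $ (j + 1) = 0\<close>.\<close>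
  have u_index: "u $ i = 0" if "i < n" for i
  proof (cases i)
    case 0
    have "u $ 0 = (R *\<^sub>v y) $ 0"
      using V R y k n by (simp add: u_def scalar_prod_def R_def)
    then show ?thesis using Ry 0 k n by simp
  next
    case (Suc j)
    then have j: "Suc j < n" using that by simp
    have "0 = (A *\<^sub>v u) $ j" using \<open>A *\<^sub>v u = 0\<^sub>v n\<close> j by simp
    also have "\<dots> = (\<Sum>l<n. (if l = j + 1 then w (j + 1) else 0) * u $ l)"
      using u j unfolding A weighted_shift_mat_def by (simp add: scalar_prod_def lessThan_atLeast0)
    also have "\<dots> = w (Suc j) * u $ Suc j"
      using j by (simp add: if_distrib[of "\<lambda>a. a * _"] cong: if_cong)
    finally show ?thesis using w[of "Suc j"] j Suc by simp
  qed
  have "u = 0\<^sub>v n" using u u_index by auto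
  have "y = (W * V) *\<^sub>v y" using y by (simp add: WV)
  also have "\<dots> = W *\<^sub>v u" unfolding u_def using W V y by simp
  finally have "y = 0\<^sub>v k" using W \<open>u = 0\<^sub>v n\<close> by (simp add: mult_mat_zero_vec)
  then have "z = 0\<^sub>v (k + k)" unfolding zxy x0 by (intro eq_vecI) auto
  with z show False by simp
qed

lemma zero_dilation_index_weighted_shift:
  assumes n: "n \<ge> 1" and w: "\<And>j. 1 \<le> j \<Longrightarrow> j \<le> n - 1 \<Longrightarrow> w j \<noteq> 0"
  shows "zero_dilation_index (weighted_shift_mat n w) = (n + 1) div 2"
proof -
  let ?A = "weighted_shift_mat n w" and ?k = "(n + 1) div 2"
  have dim: "dim_row ?A = n" "dim_col ?A = n" unfolding weighted_shift_mat_def by simp_all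
  have le: "k \<le> ?k" if "k \<in> zero_dilation_dims ?A" for k
  proof -
    from that obtain V where V: "V \<in> carrier_mat (dim_row ?A) k" "mat_adjoint V * V = 1\<^sub>m k" "mat_adjoint V * ?A * V = 0\<^sub>m k k"
      unfolding zero_dilation_dims_def by blast
    note V = V[unfolded dim]
    have "mat_adjoint V \<in> carrier_mat k n" using V by (intro carrier_matI) auto
    from weighted_shift_compression_zero_dim_le[OF n w refl V(1) this V(2,3)]
    show ?thesis by simp
  qed
  have mem: "?k \<in> zero_dilation_dims ?A"
  proof -
    \<comment> \<open>Here \<open>2 * j < n\<close> for every \<open>j < ?k\<close>, so each column
      really is a unit vector.\<close>
    define V :: "complex mat" where "V = mat n ?k (\<lambda>(i, j). if i = 2 * j then 1 else 0)"
    have V: "V \<in> carrier_mat n ?k" unfolding V_def by simp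
    have "mat_adjoint V * V = 1\<^sub>m ?k"
    proof (rule eq_matI)
      fix i j assume "i < dim_row (1\<^sub>m ?k :: complex mat)" "j < dim_col (1\<^sub>m ?k :: complex mat)"
      then have ij: "i < ?k" "j < ?k" by simp_all
      have "(mat_adjoint V * V) $$ (i, j) = (\<Sum>l<n. cnj (V $$ (l, i)) * V $$ (l, j))"
        using V ij by (simp add: scalar_prod_def lessThan_atLeast0 mat_adjoint_index)
      also have "\<dots> = (\<Sum>l<n. if l = 2 * j then (if i = j then 1 else 0) else 0)"
        using ij by (intro sum.cong) (auto simp: V_def)
      also have "\<dots> = 1\<^sub>m ?k $$ (i, j)"
        using ij by auto
      finally show "(mat_adjoint V * V) $$ (i, j) = 1\<^sub>m ?k $$ (i, j)" .
    qed (use V in auto)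
    moreover have "mat_adjoint V * ?A * V = 0\<^sub>m ?k ?k"
    proof (rule eq_matI)
      fix i j assume "i < dim_row (0\<^sub>m ?k ?k :: complex mat)" "j < dim_col (0\<^sub>m ?k ?k :: complex mat)"
      then have ij: "i < ?k" "j < ?k" by simp_all
      define B where "B = mat_adjoint V * ?A"
      have B: "B \<in> carrier_mat ?k n" using V dim unfolding B_def by (intro carrier_matI) auto
      have "B $$ (i, l) * V $$ (l, j) = 0" if "l < n" for l
      proof -
        have "B $$ (i, l) = (\<Sum>m<n. cnj (V $$ (m, i)) * ?A $$ (m, l))"
          using V ij dim that by (simp add: B_def scalar_prod_def lessThan_atLeast0 mat_adjoint_index)
        also have "\<dots> * V $$ (l, j) = 0"
          \<comment> \<open>A nonzero term would need \<open>m = 2 * i\<close>,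
            \<open>l = m + 1\<close> and \<open>l = 2 * j\<close>, which parity forbids.\<close>
          using ij that by (auto simp: sum_distrib_right V_def weighted_shift_mat_def intro!: sum.neutral) presburger+
        finally show ?thesis .
      qed
      then have "(B * V) $$ (i, j) = 0"
        using V B ij by (auto simp: scalar_prod_def intro!: sum.neutral)
      then show "(mat_adjoint V * ?A * V) $$ (i, j) = 0\<^sub>m ?k ?k $$ (i, j)" using ij by (simp add: B_def)
    qed (use V in auto)
    ultimately show ?thesis
      using V n unfolding zero_dilation_dims_def dim by auto
  qed
  have "finite (zero_dilation_dims ?A)" using le by (auto intro: finite_subset[of _ "{..?k}"])
  then have "Max (zero_dilation_dims ?A) = ?k"
    using le mem by (intro Max_eqI) auto
  then show ?thesis using mem unfolding zero_dilation_index_def by auto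
qed

section \<open>The real part of the rotated shift, and the conclusion\<close>

lemma Re_mat_weighted_shift:
  fixes c :: complex and w :: "nat \<Rightarrow> complex"
  defines "b \<equiv> \<lambda>i. c * w (Suc i) / 2"
  shows "Re_mat (c \<cdot>\<^sub>m weighted_shift_mat n w) = zero_diag_mat b (\<lambda>i. cnj (b i)) n"
  unfolding Re_mat_def b_def
  by (rule eq_matI) (auto simp: weighted_shift_mat_def tridiag_mat_def mat_adjoint_index)

theorem corollary2p7:
  fixes n :: nat and w :: "nat \<Rightarrow> complex" and A :: "complex mat" and \<theta> :: real
  assumes "n \<ge> 1"
    and "\<And>j. 1 \<le> j \<Longrightarrow> j \<le> n - 1 \<Longrightarrow> w j \<noteq> 0"
    and "A = weighted_shift_mat n w"
  shows "zero_dilation_index A =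
           num_nonneg_eigenvalues (Re_mat (exp (- (\<i> * complex_of_real \<theta>)) \<cdot>\<^sub>m A))
       \<and> int (num_nonneg_eigenvalues (Re_mat (exp (- (\<i> * complex_of_real \<theta>)) \<cdot>\<^sub>m A)))
           = \<lceil>real n / 2\<rceil>"
proof -
  define b where "b = (\<lambda>i. exp (- (\<i> * complex_of_real \<theta>)) * w (Suc i) / 2)"
  let ?C = "zero_diag_mat b (\<lambda>i. cnj (b i)) n"
  have C: "Re_mat (exp (- (\<i> * complex_of_real \<theta>)) \<cdot>\<^sub>m A) = ?C"
    unfolding assms(3) b_def by (rule Re_mat_weighted_shift)
  \<comment> \<open>The phase never vanishes, so the off-diagonal entries stay nonzero for every
    \<open>\<theta>\<close>.\<close>
  have b: "b i \<noteq> 0" if "Suc i < n" for i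
    using assms(2)[of "Suc i"] that by (simp add: b_def)
  have "2 * num_nonneg_eigenvalues ?C = n + order 0 (char_poly ?C)"
  proof (rule num_nonneg_eigenvalues_symmetric)
    show "x \<in> \<real>" if "eigenvalue ?C x" for x
      by (rule hermitian_eigenvalue_real[OF _ _ that]) (auto simp: tridiag_mat_def)
  qed (simp_all add: order_char_poly_zero_diag_mat_uminus)
  also have "order 0 (char_poly ?C) = n mod 2"
    using b by (rule order_0_char_poly_hermitian_zero_diag_mat)
  finally have count: "num_nonneg_eigenvalues ?C = (n + 1) div 2"
    by presburger
  have "\<lceil>real n / 2\<rceil> = int ((n + 1) div 2)"
    
  proof (rule ceiling_unique)
    have "n \<le> 2 * ((n + 1) div 2)" "2 * ((n + 1) div 2) \<le> n + 1" by auto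
    then have "real n \<le> 2 * real ((n + 1) div 2)" "2 * real ((n + 1) div 2) \<le> real n + 1"
      by linarith+
    then show "real_of_int (int ((n + 1) div 2)) - 1 < real n / 2"
      "real n / 2 \<le> real_of_int (int ((n + 1) div 2))" by simp_all
  qed
  then show ?thesis
    using zero_dilation_index_weighted_shift[OF assms(1,2)] count unfolding C by (simp add: assms(3))
qed

end
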